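(* Let $\mathcal T=\{t\in[0,\infty):\mathsf P(\gamma\ge t)>0\}$. Let $F=(F(t))_{t\in\mathcal T}$ be an $\mathcal H$-measurable process with càdlàg paths, and let $L$ be an arbitrary random variable. Consider the process $M=(M_t)_{t\in[0,\infty)}$ defined by $$M_t=F(t)\mathbf 1_{\{t<\gamma\}}+L\,\mathbf 1_{\{t\ge\gamma\}}.$$ Then the following statements are equivalent: 1. The process $(M_t)_{t\in\mathcal T}$ is a martingale (with respect to $(\mathcal F_t)_{t\in\mathcal T}$). 2. For all $t\in\mathcal T$, $\mathsf E(|M_t|)<\infty$ and $\mathsf E(M_t-M_0\mid\mathcal H)=0$ a.s.
   Context: $(\Omega,\mathcal F,\mathsf P)$ is a probability space, $\mathcal H\subset\mathcal F$ is a sub-$\sigma$-algebra, and $\gamma$ is a random variable with values in $[0,\infty]$ such that $\mathsf P(\gamma>0)=1$. For $t\in[0,\infty)$, $\mathcal F_t$ is the collection of all $A\in\mathcal F$ for which there exists $C\in\mathcal H$ with $A\cap\{t<\gamma\}=C\cap\{t<\gamma\}$; $(\mathcal F_t)_{t\ge 0}$ is a right-continuous filtration. Standing assumption: this filtration contains all $\mathsf P$-null sets of $\mathcal F$ (so it satisfies the usual conditions). $F$ being an $\mathcal H$-measurable process means each $F(t)$ is an $\mathcal H$-measurable random variable; $L$ is $\mathcal F$-measurable. For $t\notin\mathcal T$ the event $\{t<\gamma\}$ is $\mathsf P$-null and the term $F(t)\mathbf 1_{\{t<\gamma\}}$ is read as $0$. *)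

theory Defs
  imports "HOL-Probability.Probability"
begin

(* For t >= 0 the generating collection is already a sigma-algebra, see
   sets_single_jump_filtration below. Negative t give the same as t = 0, since
   ennreal t = 0 there; they play no role. *)
definition single_jump_filtration ::
  "'a measure \<Rightarrow> 'a measure \<Rightarrow> ('a \<Rightarrow> ennreal) \<Rightarrow> real \<Rightarrow> 'a measure" where
  "single_jump_filtration P H \<gamma> t = sigma (space P)
     {A \<in> sets P. \<exists>C \<in> sets H.
        A \<inter> {\<omega> \<in> space P. ennreal t < \<gamma> \<omega>} = C \<inter> {\<omega> \<in> space P. ennreal t < \<gamma> \<omega>}}"

definition time_set :: "'a measure \<Rightarrow> ('a \<Rightarrow> ennreal) \<Rightarrow> real set" where
  "time_set P \<gamma> = {t. 0 \<le> t \<and> measure P {\<omega> \<in> space P. ennreal t \<le> \<gamma> \<omega>} > 0}"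

(* For t outside T the family F is undefined (its values are irrelevant) and the
   first summand is read as 0. *)
definition single_jump_process ::
  "real set \<Rightarrow> ('a \<Rightarrow> ennreal) \<Rightarrow> (real \<Rightarrow> 'a \<Rightarrow> real) \<Rightarrow> ('a \<Rightarrow> real) \<Rightarrow> real \<Rightarrow> 'a \<Rightarrow> real" where
  "single_jump_process T \<gamma> F L t \<omega> =
     (if t \<in> T then F t \<omega> * indicator {\<omega>. ennreal t < \<gamma> \<omega>} \<omega> else 0)
     + L \<omega> * indicator {\<omega>. \<gamma> \<omega> \<le> ennreal t} \<omega>"

(* Right and left limits are taken within I; at a one-sided endpoint of I the
   corresponding filter is trivial and the condition void. *)
definition cadlag_on :: "real set \<Rightarrow> (real \<Rightarrow> real) \<Rightarrow> bool" where
  "cadlag_on I f \<longleftrightarrow> (\<forall>t\<in>I.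
     (f \<longlongrightarrow> f t) (at t within (I \<inter> {t<..})) \<and>
     (\<exists>l. (f \<longlongrightarrow> l) (at t within (I \<inter> {..<t}))))"

definition martingale_on ::
  "'a measure \<Rightarrow> real set \<Rightarrow> (real \<Rightarrow> 'a measure) \<Rightarrow> (real \<Rightarrow> 'a \<Rightarrow> real) \<Rightarrow> bool" where
  "martingale_on P I G X \<longleftrightarrow>
     (\<forall>t\<in>I. X t \<in> borel_measurable (G t)) \<and>
     (\<forall>t\<in>I. integrable P (X t)) \<and>
     (\<forall>s\<in>I. \<forall>t\<in>I. s \<le> t \<longrightarrow> (AE \<omega> in P. real_cond_exp P (G s) (X t) \<omega> = X s \<omega>))"

lemma space_single_jump_filtration [simp]:
  "space (single_jump_filtration P H \<gamma> t) = space P"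
  unfolding single_jump_filtration_def
  by (rule space_measure_of) (auto dest: sets.sets_into_space)

lemma sets_single_jump_filtration:
  assumes "subalgebra P H"
  shows "sets (single_jump_filtration P H \<gamma> t) =
    {A \<in> sets P. \<exists>C \<in> sets H.
        A \<inter> {\<omega> \<in> space P. ennreal t < \<gamma> \<omega>} = C \<inter> {\<omega> \<in> space P. ennreal t < \<gamma> \<omega>}}"
    (is "_ = ?A")
proof -
  let ?G = "{\<omega> \<in> space P. ennreal t < \<gamma> \<omega>}"
  have sp: "space H = space P" using assms by (simp add: subalgebra_def)
  have "sigma_algebra (space P) ?A"
    unfolding sigma_algebra_iff2
  proof (intro conjI ballI allI impI)
    show "?A \<subseteq> Pow (space P)" by (auto dest: sets.sets_into_space)
    show "{} \<in> ?A" by auto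
    fix A assume "A \<in> ?A"
    then obtain C where C: "A \<in> sets P" "C \<in> sets H" "A \<inter> ?G = C \<inter> ?G" by blast
    have "space P - C \<in> sets H" using C(2) sp by (metis sets.compl_sets)
    moreover have "(space P - A) \<inter> ?G = (space P - C) \<inter> ?G" using C(3) by blast
    ultimately show "space P - A \<in> ?A" using C(1) by blast
  next
    fix A :: "nat \<Rightarrow> 'a set" assume A: "range A \<subseteq> ?A"
    then have "\<forall>i. \<exists>C\<in>sets H. A i \<inter> ?G = C \<inter> ?G" by blast
    then obtain C where C: "\<And>i. C i \<in> sets H" "\<And>i. A i \<inter> ?G = C i \<inter> ?G" by metis
    have "(\<Union>i. A i) \<inter> ?G = (\<Union>i. C i) \<inter> ?G" using C(2) by blast
    moreover have "(\<Union>i. C i) \<in> sets H" using C(1) by blast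
    moreover have "(\<Union>i. A i) \<in> sets P" using A by blast
    ultimately show "(\<Union>i. A i) \<in> ?A" by blast
  qed
  then show ?thesis
    unfolding single_jump_filtration_def by (simp add: sigma_algebra.sets_measure_of_eq)
qed

lemma subalgebra_single_jump_filtration:
  assumes "subalgebra P H"
  shows "subalgebra P (single_jump_filtration P H \<gamma> t)"
  unfolding subalgebra_def by (auto simp: sets_single_jump_filtration[OF assms])

lemma filtration_single_jump_filtration:
  assumes "subalgebra P H"
  shows "filtration (space P) (single_jump_filtration P H \<gamma>)"
proof
  fix s t :: real assume "s \<le> t"
  then have *: "{\<omega> \<in> space P. ennreal t < \<gamma> \<omega>} \<subseteq> {\<omega> \<in> space P. ennreal s < \<gamma> \<omega>}"
    by (auto intro: le_less_trans ennreal_leI)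
  show "sets (single_jump_filtration P H \<gamma> s) \<subseteq> sets (single_jump_filtration P H \<gamma> t)"
    unfolding sets_single_jump_filtration[OF assms] using * by blast
qed simp

end

theory Submission
  imports Defs
begin

text \<open>
  The filtration is designed so that on \<open>{s < \<gamma>}\<close> the \<sigma>-algebra \<open>F\<^sub>s\<close> contains
  nothing but the trace of \<open>H\<close>, whereas an increment \<open>M\<^sub>t - M\<^sub>s\<close> with \<open>s \<le> t\<close> vanishes
  on \<open>{\<gamma> \<le> s}\<close>, where both values equal \<open>L\<close>.  A random variable \<open>Z\<close> that vanishes
  off \<open>{s < \<gamma>}\<close> cannot distinguish an event \<open>A\<close> of \<open>F\<^sub>s\<close> from the event \<open>C\<close> of \<open>H\<close>
  that has the same trace: the integrals of \<open>Z\<close> over \<open>A\<close> and over \<open>C\<close> agree.  Hence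
  \<open>E(Z | F\<^sub>s) = 0\<close> and \<open>E(Z | H) = 0\<close> are the same condition
  (\<open>cond_exp_single_jump_eq_0_iff\<close>).

  As \<open>M\<close> is adapted (\<open>single_jump_process_adapted\<close>), the martingale property
  of an integrable \<open>M\<close> says that \<open>E(M\<^sub>t - M\<^sub>s | F\<^sub>s) = 0\<close> for all \<open>s \<le> t\<close>, and so that
  \<open>E(M\<^sub>t - M\<^sub>s | H) = 0\<close>.  The conditioning \<sigma>-algebra no longer depends on \<open>s\<close>, so by
  linearity it is enough to know this for \<open>s = 0\<close>.
\<close>

lemma subalgebra_single_jump_filtration_base:
  assumes "subalgebra P H"
  shows "subalgebra (single_jump_filtration P H \<gamma> t) H"
  using assms unfolding subalgebra_def sets_single_jump_filtration[OF assms] by auto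

text \<open>
  Before the jump the process is \<open>F t\<close>, so the trace on \<open>{t < \<gamma>}\<close> of a preimage under the
  process comes from \<open>H\<close>; the behaviour of \<open>L\<close> after the jump is unrestricted by
  the filtration at time \<open>t\<close>.
\<close>
lemma single_jump_process_adapted:
  assumes sub: "subalgebra P H"
    and \<gamma>: "\<gamma> \<in> borel_measurable P"
    and t: "t \<in> T"
    and F: "F t \<in> borel_measurable H"
    and L: "L \<in> borel_measurable P"
  shows "single_jump_process T \<gamma> F L t \<in> borel_measurable (single_jump_filtration P H \<gamma> t)"
    (is "?X \<in> borel_measurable ?G")
proof (rule measurableI)
  fix B :: "real set" assume B: "B \<in> sets borel"
  have [measurable]: "\<gamma> \<in> borel_measurable P" "L \<in> borel_measurable P" "F t \<in> borel_measurable P"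
    using \<gamma> L measurable_from_subalg[OF sub F] by auto
  have "?X \<in> borel_measurable P"
    unfolding single_jump_process_def by measurable
  then have "?X -` B \<inter> space P \<in> sets P" using B by (rule measurable_sets)
  moreover have "F t -` B \<inter> space P \<in> sets H"
    using measurable_sets[OF F B] sub by (simp add: subalgebra_def)
  moreover have "(?X -` B \<inter> space P) \<inter> {\<omega> \<in> space P. ennreal t < \<gamma> \<omega>} =
      (F t -` B \<inter> space P) \<inter> {\<omega> \<in> space P. ennreal t < \<gamma> \<omega>}"
    using t by (auto simp: single_jump_process_def)
  ultimately show "?X -` B \<inter> space ?G \<in> sets ?G"
    by (auto simp: sets_single_jump_filtration[OF sub])
qed simp

lemma single_jump_process_constant_after_jump:
  assumes "s \<le> t" "\<gamma> \<omega> \<le> ennreal s"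
  shows "single_jump_process T \<gamma> F L t \<omega> = single_jump_process T \<gamma> F L s \<omega>"
proof -
  have "\<gamma> \<omega> \<le> ennreal t" using assms ennreal_leI order_trans by blast
  with assms(2) show ?thesis by (simp add: single_jump_process_def)
qed

lemma (in sigma_finite_subalgebra) cond_exp_eq_0_iff_set_integral:
  assumes "integrable M Z"
  shows "(AE \<omega> in M. real_cond_exp M F Z \<omega> = 0) \<longleftrightarrow>
    (\<forall>A\<in>sets F. set_lebesgue_integral M A Z = 0)"
proof
  assume 0: "AE \<omega> in M. real_cond_exp M F Z \<omega> = 0"
  show "\<forall>A\<in>sets F. set_lebesgue_integral M A Z = 0"
  proof
    fix A assume A: "A \<in> sets F"
    have "set_lebesgue_integral M A Z = set_lebesgue_integral M A (real_cond_exp M F Z)"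
      by (rule real_cond_exp_intA[OF assms A])
    also have "\<dots> = 0"
      unfolding set_lebesgue_integral_def
      by (rule integral_eq_zero_AE) (use 0 in auto)
    finally show "set_lebesgue_integral M A Z = 0" .
  qed
next
  assume "\<forall>A\<in>sets F. set_lebesgue_integral M A Z = 0"
  then show "AE \<omega> in M. real_cond_exp M F Z \<omega> = 0"
    by (intro real_cond_exp_charact) (auto simp: assms set_lebesgue_integral_def)
qed

lemma (in finite_measure) sigma_finite_subalgebraI:
  assumes "subalgebra M F"
  shows "sigma_finite_subalgebra M F"
proof -
  interpret finite_measure_subalgebra M F by unfold_locales (rule assms)
  show ?thesis by unfold_locales
qed

text \<open>
  Every event of \<open>F\<^sub>s\<close> agrees on \<open>{s < \<gamma>}\<close> with an event of \<open>H\<close>, and the integral of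
  \<open>Z\<close> over an event depends only on this trace.
\<close>
lemma cond_exp_single_jump_eq_0_iff:
  assumes fin: "finite_measure P"
    and sub: "subalgebra P H"
    and Z: "integrable P Z"
    and Z0: "\<And>\<omega>. \<omega> \<in> space P \<Longrightarrow> \<gamma> \<omega> \<le> ennreal s \<Longrightarrow> Z \<omega> = 0"
  shows "(AE \<omega> in P. real_cond_exp P (single_jump_filtration P H \<gamma> s) Z \<omega> = 0) \<longleftrightarrow>
    (AE \<omega> in P. real_cond_exp P H Z \<omega> = 0)"
proof -
  let ?G = "single_jump_filtration P H \<gamma> s"
  let ?E = "{\<omega> \<in> space P. ennreal s < \<gamma> \<omega>}"
  have subG: "subalgebra P ?G" by (rule subalgebra_single_jump_filtration[OF sub])
  have trace: "set_lebesgue_integral P A Z = set_lebesgue_integral P C Z"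
    if "A \<inter> ?E = C \<inter> ?E" for A C
    unfolding set_lebesgue_integral_def
  proof (rule Bochner_Integration.integral_cong[OF refl])
    fix \<omega> assume w: "\<omega> \<in> space P"
    show "indicat_real A \<omega> *\<^sub>R Z \<omega> = indicat_real C \<omega> *\<^sub>R Z \<omega>"
    proof (cases "\<gamma> \<omega> \<le> ennreal s")
      case True
      then show ?thesis using Z0[OF w] by simp
    next
      case False
      then have "\<omega> \<in> ?E" using w by auto
      then have "\<omega> \<in> A \<longleftrightarrow> \<omega> \<in> C" using that by blast
      then show ?thesis by (simp add: indicator_def)
    qed
  qed
  have "(\<forall>A\<in>sets ?G. set_lebesgue_integral P A Z = 0) \<longleftrightarrow>
      (\<forall>C\<in>sets H. set_lebesgue_integral P C Z = 0)"
  proof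
    assume "\<forall>A\<in>sets ?G. set_lebesgue_integral P A Z = 0"
    then show "\<forall>C\<in>sets H. set_lebesgue_integral P C Z = 0"
      using subalgebra_single_jump_filtration_base[OF sub, of \<gamma> s] by (auto simp: subalgebra_def)
  next
    assume 0: "\<forall>C\<in>sets H. set_lebesgue_integral P C Z = 0"
    show "\<forall>A\<in>sets ?G. set_lebesgue_integral P A Z = 0"
    proof
      fix A assume "A \<in> sets ?G"
      then obtain C where "C \<in> sets H" "A \<inter> ?E = C \<inter> ?E"
        unfolding sets_single_jump_filtration[OF sub] by blast
      then show "set_lebesgue_integral P A Z = 0" using trace 0 by metis
    qed
  qed
  then show ?thesis
    using sigma_finite_subalgebra.cond_exp_eq_0_iff_set_integral[OF
        finite_measure.sigma_finite_subalgebraI[OF fin subG] Z]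
      sigma_finite_subalgebra.cond_exp_eq_0_iff_set_integral[OF
        finite_measure.sigma_finite_subalgebraI[OF fin sub] Z]
    by simp
qed

lemma (in sigma_finite_subalgebra) cond_exp_eq_iff_cond_exp_diff_eq_0:
  assumes X: "integrable M X" and Y: "integrable M Y" "Y \<in> borel_measurable F"
  shows "(AE \<omega> in M. real_cond_exp M F X \<omega> = Y \<omega>) \<longleftrightarrow>
    (AE \<omega> in M. real_cond_exp M F (\<lambda>\<omega>. X \<omega> - Y \<omega>) \<omega> = 0)"
proof -
  have "AE \<omega> in M. real_cond_exp M F (\<lambda>\<omega>. X \<omega> - Y \<omega>) \<omega> =
      real_cond_exp M F X \<omega> - Y \<omega>"
    using real_cond_exp_diff[OF X Y(1)] real_cond_exp_F_meas[OF Y] by eventually_elim simp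
  then have "AE \<omega> in M. real_cond_exp M F X \<omega> = Y \<omega> \<longleftrightarrow>
      real_cond_exp M F (\<lambda>\<omega>. X \<omega> - Y \<omega>) \<omega> = 0"
    by eventually_elim simp
  then show ?thesis by (rule eventually_subst)
qed

theorem theorem3p1:
  fixes P H :: "'a measure" and \<gamma> :: "'a \<Rightarrow> ennreal"
    and F :: "real \<Rightarrow> 'a \<Rightarrow> real" and L :: "'a \<Rightarrow> real"
  defines "T \<equiv> time_set P \<gamma>"
    and "G \<equiv> single_jump_filtration P H \<gamma>"
    and "M \<equiv> single_jump_process (time_set P \<gamma>) \<gamma> F L"
  assumes "prob_space P"
    and "subalgebra P H"
    and "\<gamma> \<in> borel_measurable P"
    and "measure P {\<omega> \<in> space P. 0 < \<gamma> \<omega>} = 1"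
    and "\<And>t. 0 \<le> t \<Longrightarrow> null_sets P \<subseteq> sets (G t)"
    and "\<And>t. t \<in> T \<Longrightarrow> F t \<in> borel_measurable H"
    and "\<And>\<omega>. \<omega> \<in> space P \<Longrightarrow> cadlag_on T (\<lambda>t. F t \<omega>)"
    and "L \<in> borel_measurable P"
  shows "martingale_on P T G M \<longleftrightarrow>
    (\<forall>t\<in>T. (\<integral>\<^sup>+\<omega>. ennreal \<bar>M t \<omega>\<bar> \<partial>P) < \<infinity> \<and>
           (AE \<omega> in P. real_cond_exp P H (\<lambda>\<omega>. M t \<omega> - M 0 \<omega>) \<omega> = 0))"
proof -
  let ?E = "\<lambda>s t. AE \<omega> in P. real_cond_exp P H (\<lambda>\<omega>. M t \<omega> - M s \<omega>) \<omega> = 0"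
  interpret prob_space P by fact
  note sub = \<open>subalgebra P H\<close>
  interpret H: sigma_finite_subalgebra P H by (rule sigma_finite_subalgebraI[OF sub])
  have subG: "subalgebra P (G t)" for t
    unfolding G_def by (rule subalgebra_single_jump_filtration[OF sub])
  have adapted: "M t \<in> borel_measurable (G t)" if "t \<in> T" for t
    unfolding M_def G_def using that assms by (intro single_jump_process_adapted) (auto simp: T_def)
  have meas: "M t \<in> borel_measurable P" if "t \<in> T" for t
    by (rule measurable_from_subalg[OF subG adapted[OF that]])
  have zero_in_T: "0 \<in> T"
    by (simp add: T_def time_set_def prob_space)
  have nonneg: "0 \<le> t" if "t \<in> T" for t
    using that by (simp add: T_def time_set_def)
  have integrable_iff: "integrable P (M t) \<longleftrightarrow> (\<integral>\<^sup>+\<omega>. ennreal \<bar>M t \<omega>\<bar> \<partial>P) < \<infinity>"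
    if "t \<in> T" for t
    using meas[OF that] by (simp add: integrable_iff_bounded)
  have increment: "(AE \<omega> in P. real_cond_exp P (G s) (M t) \<omega> = M s \<omega>) \<longleftrightarrow> ?E s t"
    if "s \<in> T" "t \<in> T" "s \<le> t" and int: "\<forall>t\<in>T. integrable P (M t)" for s t
  proof -
    have "integrable P (\<lambda>\<omega>. M t \<omega> - M s \<omega>)"
      using that by (intro Bochner_Integration.integrable_diff) auto
    moreover have "M t \<omega> - M s \<omega> = 0" if "\<gamma> \<omega> \<le> ennreal s" for \<omega>
      unfolding M_def using single_jump_process_constant_after_jump[OF \<open>s \<le> t\<close>] that by simp
    ultimately have "(AE \<omega> in P. real_cond_exp P (G s) (\<lambda>\<omega>. M t \<omega> - M s \<omega>) \<omega> = 0) \<longleftrightarrow> ?E s t"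
      unfolding G_def
      by (intro cond_exp_single_jump_eq_0_iff[OF finite_measure_axioms sub]) auto
    then show ?thesis
      using that adapted sigma_finite_subalgebra.cond_exp_eq_iff_cond_exp_diff_eq_0[OF
          sigma_finite_subalgebraI[OF subG]] by blast
  qed
  have from_zero: "?E s t" if "s \<in> T" "t \<in> T" "?E 0 s" "?E 0 t"
    and int: "\<forall>t\<in>T. integrable P (M t)" for s t
  proof -
    have "integrable P (\<lambda>\<omega>. M r \<omega> - M 0 \<omega>)" if "r \<in> T" for r
      using int that zero_in_T by (intro Bochner_Integration.integrable_diff) auto
    from H.real_cond_exp_diff[OF this[OF \<open>t \<in> T\<close>] this[OF \<open>s \<in> T\<close>]] \<open>?E 0 s\<close> \<open>?E 0 t\<close>
    show ?thesis by eventually_elim simp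
  qed
  show ?thesis
  proof
    assume mart: "martingale_on P T G M"
    then have int: "\<forall>t\<in>T. integrable P (M t)" by (simp add: martingale_on_def)
    show "\<forall>t\<in>T. (\<integral>\<^sup>+\<omega>. ennreal \<bar>M t \<omega>\<bar> \<partial>P) < \<infinity> \<and> ?E 0 t"
    proof (intro ballI conjI)
      fix t assume t: "t \<in> T"
      show "(\<integral>\<^sup>+\<omega>. ennreal \<bar>M t \<omega>\<bar> \<partial>P) < \<infinity>"
        using int integrable_iff[OF t] t by blast
      have "AE \<omega> in P. real_cond_exp P (G 0) (M t) \<omega> = M 0 \<omega>"
        using mart t zero_in_T nonneg[OF t] unfolding martingale_on_def by blast
      then show "?E 0 t"
        using increment[OF zero_in_T t nonneg[OF t] int] by (rule iffD1[rotated])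
    qed
  next
    assume *: "\<forall>t\<in>T. (\<integral>\<^sup>+\<omega>. ennreal \<bar>M t \<omega>\<bar> \<partial>P) < \<infinity> \<and> ?E 0 t"
    then have int: "\<forall>t\<in>T. integrable P (M t)" using integrable_iff by blast
    show "martingale_on P T G M"
      unfolding martingale_on_def
    proof (intro conjI ballI impI)
      fix s t assume st: "s \<in> T" "t \<in> T" "s \<le> t"
      have "?E s t"
        using * st by (intro from_zero[OF st(1,2) _ _ int]) blast+
      then show "AE \<omega> in P. real_cond_exp P (G s) (M t) \<omega> = M s \<omega>"
        by (rule iffD2[OF increment[OF st int]])
    qed (use adapted int in blast)+
  qed
qed

end
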